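(* Let $\mathcal{I}$ be a finite parameter set; for every $p\in\mathcal{I}$ and level $\ell\in\mathbb{N}_0$ let $A_\ell(p)$ be a real symmetric positive definite matrix and $S_\ell(p)$ a matrix of the same size (the iteration matrix of the smoother), and for $\ell\in\mathbb{N}$ let $P_\ell(p)$ (prolongation) and $R_\ell(p)$ (restriction) be matrices mapping level $\ell-1$ to level $\ell$ and level $\ell$ to level $\ell-1$, respectively. Assume that the smoothing property holds with $\overline{\nu}(h)=\infty$ and function $\eta$, and that the approximation property holds with constant $C_A>0$. Then for every given $0<\zeta<1$ there exists a lower bound $\underline{\nu}\in\mathbb{N}_0$ such that $$\left\lVert M_\ell^{\mathrm{TGM}(\nu,0)}(p)\right\rVert_2\le C_A\,\eta(\nu)\le\zeta$$ holds for all $\nu\ge\underline{\nu}$, $\ell\in\mathbb{N}$ and $p\in\mathcal{I}$.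
   Context: $\lVert\cdot\rVert_2$ is the spectral norm. The iteration matrix of the two-grid method with $\nu$ presmoothing steps and no postsmoothing steps is $$M_\ell^{\mathrm{TGM}(\nu,0)}(p)=\left(\mathrm{Id}-P_\ell(p)A_{\ell-1}^{-1}(p)R_\ell(p)A_\ell(p)\right)S_\ell^{\nu}(p).$$ Smoothing property with $\overline\nu(h)=\infty$: there is a function $\eta$ on $\mathbb{N}_0$, independent of the level $\ell$, with $\lim_{\nu\to\infty}\eta(\nu)=0$ such that $\lVert A_\ell(p)S_\ell^{\nu}(p)\rVert_2\le\eta(\nu)\lVert A_\ell(p)\rVert_2$ for all integers $\nu\ge0$, all $p\in\mathcal{I}$ and all $\ell\in\mathbb{N}_0$. Approximation property: there is a constant $C_A>0$ independent of $\ell$ with $$\left\lVert A_\ell^{-1}(p)-P_\ell(p)A_{\ell-1}^{-1}(p)R_\ell(p)\right\rVert_2\le\frac{C_A}{\lVert A_\ell(p)\rVert_2}\quad\text{for all }\ell\in\mathbb{N}\text{ and all }p\in\mathcal{I}.$$ *)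

theory Defs
  imports Complex_Main "Jordan_Normal_Form.Gauss_Jordan_Elimination"
begin

definition vec_norm2 :: "real vec \<Rightarrow> real" where
  "vec_norm2 v = sqrt (v \<bullet> v)"

(* The spectral norm as the matrix norm induced by the Euclidean vector norm.
   The set of values is nonempty (v = 0) and bounded above. *)
definition spectral_norm :: "real mat \<Rightarrow> real" where
  "spectral_norm A =
     (SUP v \<in> {v \<in> carrier_vec (dim_col A). vec_norm2 v \<le> 1}. vec_norm2 (A *\<^sub>v v))"

definition sym_pos_def :: "nat \<Rightarrow> real mat \<Rightarrow> bool" where
  "sym_pos_def n A \<longleftrightarrow> A \<in> carrier_mat n n \<and> transpose_mat A = A \<and>
     (\<forall>v \<in> carrier_vec n. v \<noteq> 0\<^sub>v n \<longrightarrow> v \<bullet> (A *\<^sub>v v) > 0)"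

(* Unspecified for singular matrices, where mat_inverse returns None. *)
definition inv_mat :: "real mat \<Rightarrow> real mat" where
  "inv_mat A = the (mat_inverse A)"

(* Families of matrices are indexed by the level first and then by the parameter.
   The level l of the fine grid is at least 1 wherever l - 1 occurs. *)

(* Two-grid iteration with nu presmoothing and no postsmoothing steps. *)
definition two_grid_matrix ::
  "(nat \<Rightarrow> 'p \<Rightarrow> real mat) \<Rightarrow> (nat \<Rightarrow> 'p \<Rightarrow> real mat) \<Rightarrow> (nat \<Rightarrow> 'p \<Rightarrow> real mat) \<Rightarrow>
   (nat \<Rightarrow> 'p \<Rightarrow> real mat) \<Rightarrow> nat \<Rightarrow> nat \<Rightarrow> 'p \<Rightarrow> real mat" where
  "two_grid_matrix A S P R \<nu> l p =
     (1\<^sub>m (dim_row (A l p)) - P l p * inv_mat (A (l - 1) p) * R l p * A l p) * (S l p ^\<^sub>m \<nu>)"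

(* The smoothing property with no upper bound on the number of smoothing steps. *)
definition smoothing_property ::
  "'p set \<Rightarrow> (nat \<Rightarrow> 'p \<Rightarrow> real mat) \<Rightarrow> (nat \<Rightarrow> 'p \<Rightarrow> real mat) \<Rightarrow> (nat \<Rightarrow> real) \<Rightarrow> bool" where
  "smoothing_property I A S \<eta> \<longleftrightarrow> \<eta> \<longlonglongrightarrow> 0 \<and>
     (\<forall>\<nu> l. \<forall>p\<in>I. spectral_norm (A l p * (S l p ^\<^sub>m \<nu>)) \<le> \<eta> \<nu> * spectral_norm (A l p))"

definition approximation_property ::
  "'p set \<Rightarrow> (nat \<Rightarrow> 'p \<Rightarrow> real mat) \<Rightarrow> (nat \<Rightarrow> 'p \<Rightarrow> real mat) \<Rightarrow> (nat \<Rightarrow> 'p \<Rightarrow> real mat) \<Rightarrow>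
   real \<Rightarrow> bool" where
  "approximation_property I A P R C \<longleftrightarrow> C > 0 \<and>
     (\<forall>l\<ge>1. \<forall>p\<in>I. spectral_norm (inv_mat (A l p) - P l p * inv_mat (A (l - 1) p) * R l p)
        \<le> C / spectral_norm (A l p))"

end

(* Since A_l(p) is invertible, the two-grid matrix factors as
     (A_l^-1 - P_l A_{l-1}^-1 R_l) (A_l S_l^nu),
   and submultiplicativity of the spectral norm combines the two properties: the factors
   ||A_l|| cancel because a positive definite matrix of positive size is nonzero. *)
theory Submission
  imports Defs "HOL-Analysis.L2_Norm" "Jordan_Normal_Form.Determinant"
begin

text \<open>This bridge makes the theory of \<open>L2_set\<close> available for vectors:
  definiteness, monotonicity in the entries and the Cauchy-Schwarz inequality below are all taken
  from there.\<close>

lemma vec_norm2_eq_L2_set: "vec_norm2 v = L2_set (($) v) {0..<dim_vec v}"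
  by (simp add: vec_norm2_def L2_set_def scalar_prod_def power2_eq_square)

lemma vec_norm2_nonneg: "0 \<le> vec_norm2 v"
  by (simp add: vec_norm2_eq_L2_set)

lemma vec_norm2_eq_0_iff: "vec_norm2 v = 0 \<longleftrightarrow> v = 0\<^sub>v (dim_vec v)"
proof -
  have "vec_norm2 v = 0 \<longleftrightarrow> (\<forall>i<dim_vec v. v $ i = 0)"
    by (auto simp: vec_norm2_eq_L2_set L2_set_eq_0_iff)
  also have "\<dots> \<longleftrightarrow> v = 0\<^sub>v (dim_vec v)"
    unfolding vec_eq_iff by simp
  finally show ?thesis .
qed

lemma vec_norm2_smult: "vec_norm2 (c \<cdot>\<^sub>v v) = \<bar>c\<bar> * vec_norm2 v"
  by (simp add: vec_norm2_def real_sqrt_mult flip: mult.assoc)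

text \<open>Cauchy-Schwarz: after the triangle inequality for the sum,
  \<open>L2_set_mult_ineq\<close> applies to the absolute values of the entries.\<close>

lemma abs_scalar_prod_le_vec_norm2:
  assumes "dim_vec v = dim_vec w"
  shows "\<bar>v \<bullet> w\<bar> \<le> vec_norm2 v * vec_norm2 w"
proof -
  have "\<bar>v \<bullet> w\<bar> \<le> (\<Sum>i\<in>{0..<dim_vec w}. \<bar>v $ i\<bar> * \<bar>w $ i\<bar>)"
    by (simp add: scalar_prod_def sum_abs flip: abs_mult)
  also have "\<dots> \<le> vec_norm2 v * vec_norm2 w"
    by (simp add: vec_norm2_eq_L2_set assms L2_set_mult_ineq)
  finally show ?thesis .
qed

text \<open>A real supremum dominates its values only if these are bounded above, so each such use
  of \<open>spectral_norm\<close> rests on this fact. The bound found is the Frobenius norm, written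
  as the Euclidean norm of the row norms; Cauchy-Schwarz gives it row by row.\<close>

lemma bdd_above_spectral_norm:
  "bdd_above ((\<lambda>v. vec_norm2 (A *\<^sub>v v)) ` {v \<in> carrier_vec (dim_col A). vec_norm2 v \<le> 1})"
proof (rule bdd_aboveI2)
  fix v
  assume v: "v \<in> {v \<in> carrier_vec (dim_col A). vec_norm2 v \<le> 1}"
  have entry: "\<bar>row A i \<bullet> v\<bar> \<le> vec_norm2 (row A i)" if "i < dim_row A" for i
  proof -
    have "\<bar>row A i \<bullet> v\<bar> \<le> vec_norm2 (row A i) * vec_norm2 v"
      using v by (intro abs_scalar_prod_le_vec_norm2) auto
    also have "\<dots> \<le> vec_norm2 (row A i)"
      using v vec_norm2_nonneg by (simp add: mult_left_le)
    finally show ?thesis .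
  qed
  \<comment> \<open>The absolute values do not change the norm, and they supply the nonnegative
    entries that \<open>L2_set_mono\<close> requires.\<close>
  have "vec_norm2 (A *\<^sub>v v) = L2_set (\<lambda>i. \<bar>row A i \<bullet> v\<bar>) {0..<dim_row A}"
    by (simp add: vec_norm2_eq_L2_set L2_set_def)
  also have "\<dots> \<le> L2_set (\<lambda>i. vec_norm2 (row A i)) {0..<dim_row A}"
    using entry by (intro L2_set_mono) auto
  finally show "vec_norm2 (A *\<^sub>v v) \<le> L2_set (\<lambda>i. vec_norm2 (row A i)) {0..<dim_row A}" .
qed

lemma spectral_norm_nonneg: "0 \<le> spectral_norm A"
proof -
  have "vec_norm2 (A *\<^sub>v 0\<^sub>v (dim_col A)) \<le> spectral_norm A"
    unfolding spectral_norm_def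
    by (rule cSUP_upper[OF _ bdd_above_spectral_norm]) (simp add: vec_norm2_def)
  then show ?thesis
    using vec_norm2_nonneg order_trans by blast
qed

text \<open>The supremum covers only the unit ball; homogeneity of the norm extends the estimate to
  all vectors. The zero vector cannot be normalized and is treated separately.\<close>

lemma vec_norm2_mult_mat_vec_le:
  assumes v: "v \<in> carrier_vec (dim_col A)"
  shows "vec_norm2 (A *\<^sub>v v) \<le> spectral_norm A * vec_norm2 v"
proof (cases "vec_norm2 v = 0")
  case True
  then have "v = 0\<^sub>v (dim_col A)"
    using v by (simp add: vec_norm2_eq_0_iff)
  then have "A *\<^sub>v v = 0\<^sub>v (dim_row A)"
    by (intro eq_vecI) auto
  then show ?thesis
    using True by (simp add: vec_norm2_def)
next
  case False
  then have pos: "0 < vec_norm2 v"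
    using vec_norm2_nonneg[of v] by simp
  let ?u = "inverse (vec_norm2 v) \<cdot>\<^sub>v v"
  have "vec_norm2 (A *\<^sub>v ?u) \<le> spectral_norm A"
    unfolding spectral_norm_def
    using v pos by (intro cSUP_upper[OF _ bdd_above_spectral_norm]) (simp add: vec_norm2_smult)
  moreover have "A *\<^sub>v ?u = inverse (vec_norm2 v) \<cdot>\<^sub>v (A *\<^sub>v v)"
    using v by (intro mult_mat_vec) auto
  ultimately show ?thesis
    using pos by (simp add: vec_norm2_smult pos_divide_le_eq mult.commute flip: divide_inverse_commute)
qed

text \<open>On the unit ball the operator bound is applied first to \<open>A\<close> and then to
  \<open>B\<close>. Passing to the supremum by \<open>cSUP_least\<close> also requires a nonempty
  ball, which the zero vector witnesses.\<close>

lemma spectral_norm_mult_le: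
  assumes "dim_col A = dim_row B"
  shows "spectral_norm (A * B) \<le> spectral_norm A * spectral_norm B"
proof -
  let ?V = "{v \<in> carrier_vec (dim_col (A * B)). vec_norm2 v \<le> 1}"
  show ?thesis
    unfolding spectral_norm_def[of "A * B"]
  proof (rule cSUP_least)
    have "0\<^sub>v (dim_col (A * B)) \<in> ?V"
      by (simp add: vec_norm2_def)
    then show "?V \<noteq> {}"
      by blast
  next
    fix v
    assume "v \<in> ?V"
    then have v: "v \<in> carrier_vec (dim_col B)" "vec_norm2 v \<le> 1"
      by auto
    have "vec_norm2 ((A * B) *\<^sub>v v) = vec_norm2 (A *\<^sub>v (B *\<^sub>v v))"
      using v assms by (metis assoc_mult_mat_vec carrier_matI)
    also have "\<dots> \<le> spectral_norm A * vec_norm2 (B *\<^sub>v v)"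
      by (intro vec_norm2_mult_mat_vec_le) (simp add: assms carrier_vecI)
    also have "\<dots> \<le> spectral_norm A * (spectral_norm B * vec_norm2 v)"
      by (intro mult_left_mono vec_norm2_mult_mat_vec_le v spectral_norm_nonneg)
    also have "\<dots> \<le> spectral_norm A * spectral_norm B"
      using v by (intro mult_left_mono mult_left_le spectral_norm_nonneg)
    finally show "vec_norm2 ((A * B) *\<^sub>v v) \<le> spectral_norm A * spectral_norm B" .
  qed
qed

text \<open>The quadratic form at a unit vector is positive and, by Cauchy-Schwarz, at most a
  multiple of the spectral norm, which therefore cannot vanish. The assumption \<open>n > 0\<close>
  provides index 0; an empty matrix has norm 0.\<close>

lemma sym_pos_def_spectral_norm_pos:
  assumes "sym_pos_def n A" and "n > 0"
  shows "0 < spectral_norm A"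
proof -
  let ?e = "unit_vec n 0 :: real vec"
  have A: "A \<in> carrier_mat n n"
    using assms by (simp add: sym_pos_def_def)
  have "?e $ 0 \<noteq> 0\<^sub>v n $ 0"
    using assms(2) by simp
  then have "?e \<noteq> 0\<^sub>v n"
    by metis
  then have "0 < ?e \<bullet> (A *\<^sub>v ?e)"
    using assms by (simp add: sym_pos_def_def)
  also have "\<dots> \<le> vec_norm2 ?e * vec_norm2 (A *\<^sub>v ?e)"
    using abs_scalar_prod_le_vec_norm2[of ?e "A *\<^sub>v ?e"] A by auto
  also have "\<dots> \<le> vec_norm2 ?e * (spectral_norm A * vec_norm2 ?e)"
    using A by (intro mult_left_mono vec_norm2_mult_mat_vec_le vec_norm2_nonneg) auto
  finally show ?thesis
    using spectral_norm_nonneg[of A] by (cases "spectral_norm A = 0") auto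
qed

text \<open>A nonzero kernel vector would make the quadratic form vanish, so the determinant is
  nonzero. This excludes the unspecified case of \<open>inv_mat\<close>.\<close>

lemma sym_pos_def_inv_mat:
  assumes "sym_pos_def n A"
  shows "inv_mat A \<in> carrier_mat n n" and "inv_mat A * A = 1\<^sub>m n"
proof -
  have A: "A \<in> carrier_mat n n"
    using assms by (simp add: sym_pos_def_def)
  have "det A \<noteq> 0"
  proof
    assume "det A = 0"
    then obtain v where v: "v \<in> carrier_vec n" "v \<noteq> 0\<^sub>v n" "A *\<^sub>v v = 0\<^sub>v n"
      using det_0_iff_vec_prod_zero[OF A] by blast
    then have "0 < v \<bullet> (A *\<^sub>v v)"
      using assms unfolding sym_pos_def_def by blast
    then show False
      unfolding v(3) using v(1) by simp
  qed
  \<comment> \<open>\<open>mat_inverse\<close> returns \<open>None\<close> only for non-units of the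
    matrix ring, hence the detour through \<open>Units\<close>.\<close>
  then have "A \<in> Units (ring_mat TYPE(real) n ())"
    by (rule det_non_zero_imp_unit[OF A])
  then obtain B where "mat_inverse A = Some B"
    using mat_inverse(1)[OF A, where b = "()"] by (cases "mat_inverse A") auto
  then show "inv_mat A \<in> carrier_mat n n" and "inv_mat A * A = 1\<^sub>m n"
    using mat_inverse(2)[OF A] by (auto simp: inv_mat_def)
qed

lemma two_grid_matrix_factor:
  assumes A: "sym_pos_def n (A l p)" and A': "sym_pos_def m (A (l - 1) p)"
    and S: "S l p \<in> carrier_mat n n"
    and P: "P l p \<in> carrier_mat n m" and R: "R l p \<in> carrier_mat m n"
  shows "two_grid_matrix A S P R \<nu> l p =
    (inv_mat (A l p) - P l p * inv_mat (A (l - 1) p) * R l p) * (A l p * (S l p ^\<^sub>m \<nu>))"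
proof -
  have cA: "A l p \<in> carrier_mat n n"
    using A by (simp add: sym_pos_def_def)
  note inv = sym_pos_def_inv_mat[OF A]
  let ?K = "P l p * inv_mat (A (l - 1) p) * R l p"
  \<comment> \<open>Positive definiteness on the coarse level fixes the size of the coarse inverse,
    so that the coarse-grid correction is a square matrix of fine-grid size.\<close>
  have K: "?K \<in> carrier_mat n n"
    using P R sym_pos_def_inv_mat(1)[OF A'] by auto
  have "two_grid_matrix A S P R \<nu> l p = (1\<^sub>m n - ?K * A l p) * (S l p ^\<^sub>m \<nu>)"
    unfolding two_grid_matrix_def carrier_matD(1)[OF cA] ..
  \<comment> \<open>The right-hand side is expanded by distributivity, and its first term
    \<open>inv_mat (A l p) * A l p\<close> collapses to the identity.\<close>
  also have "1\<^sub>m n - ?K * A l p = (inv_mat (A l p) - ?K) * A l p"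
    unfolding minus_mult_distrib_mat[OF inv(1) K cA] inv(2) ..
  also have "\<dots> * (S l p ^\<^sub>m \<nu>) = (inv_mat (A l p) - ?K) * (A l p * (S l p ^\<^sub>m \<nu>))"
    using cA by (rule assoc_mult_mat[OF minus_carrier_mat[OF K] _ pow_carrier_mat[OF S]])
  finally show ?thesis .
qed

theorem theorem3p9:
  fixes I :: "'p set"
    and n :: "nat \<Rightarrow> 'p \<Rightarrow> nat"
    and A S P R :: "nat \<Rightarrow> 'p \<Rightarrow> real mat"
    and \<eta> :: "nat \<Rightarrow> real"
    and C\<^sub>A :: real
  assumes "finite I"
    and "\<And>l p. p \<in> I \<Longrightarrow> n l p > 0"
    and "\<And>l p. p \<in> I \<Longrightarrow> sym_pos_def (n l p) (A l p)"
    and "\<And>l p. p \<in> I \<Longrightarrow> S l p \<in> carrier_mat (n l p) (n l p)"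
    and "\<And>l p. p \<in> I \<Longrightarrow> l \<ge> 1 \<Longrightarrow> P l p \<in> carrier_mat (n l p) (n (l - 1) p)"
    and "\<And>l p. p \<in> I \<Longrightarrow> l \<ge> 1 \<Longrightarrow> R l p \<in> carrier_mat (n (l - 1) p) (n l p)"
    and "smoothing_property I A S \<eta>"
    and "approximation_property I A P R C\<^sub>A"
  shows "\<forall>\<zeta>. 0 < \<zeta> \<and> \<zeta> < 1 \<longrightarrow>
    (\<exists>\<nu>\<^sub>0::nat. \<forall>\<nu>\<ge>\<nu>\<^sub>0. \<forall>l\<ge>1. \<forall>p\<in>I.
       spectral_norm (two_grid_matrix A S P R \<nu> l p) \<le> C\<^sub>A * \<eta> \<nu> \<and> C\<^sub>A * \<eta> \<nu> \<le> \<zeta>)"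
proof (intro allI impI)
  fix \<zeta> :: real
  assume "0 < \<zeta> \<and> \<zeta> < 1"
  have smooth: "\<eta> \<longlonglongrightarrow> 0"
      "\<And>\<nu> l p. p \<in> I \<Longrightarrow>
        spectral_norm (A l p * (S l p ^\<^sub>m \<nu>)) \<le> \<eta> \<nu> * spectral_norm (A l p)"
    using assms(7) by (auto simp: smoothing_property_def)
  have approx: "C\<^sub>A > 0"
      "\<And>l p. l \<ge> 1 \<Longrightarrow> p \<in> I \<Longrightarrow>
        spectral_norm (inv_mat (A l p) - P l p * inv_mat (A (l - 1) p) * R l p)
          \<le> C\<^sub>A / spectral_norm (A l p)"
    using assms(8) by (auto simp: approximation_property_def)
  \<comment> \<open>The first inequality holds for every \<nu>; a lower bound on \<nu> is needed
    only to bring the right-hand side below \<zeta>.\<close>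
  have bound: "spectral_norm (two_grid_matrix A S P R \<nu> l p) \<le> C\<^sub>A * \<eta> \<nu>"
    if l: "l \<ge> 1" and p: "p \<in> I" for \<nu> l p
  proof -
    let ?E = "inv_mat (A l p) - P l p * inv_mat (A (l - 1) p) * R l p"
    let ?F = "A l p * (S l p ^\<^sub>m \<nu>)"
    have A: "A l p \<in> carrier_mat (n l p) (n l p)"
      using assms(3)[OF p] by (simp add: sym_pos_def_def)
    have pos: "0 < spectral_norm (A l p)"
      by (rule sym_pos_def_spectral_norm_pos[OF assms(3,2)[OF p]])
    have "two_grid_matrix A S P R \<nu> l p = ?E * ?F"
      by (rule two_grid_matrix_factor[where n = "n l p" and m = "n (l - 1) p"])
        (simp_all only: assms(3-6) l p)
    then have "spectral_norm (two_grid_matrix A S P R \<nu> l p) \<le> spectral_norm ?E * spectral_norm ?F"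
      using A assms(6)[OF p l] by (simp add: spectral_norm_mult_le)
    also have "\<dots> \<le> C\<^sub>A / spectral_norm (A l p) * (\<eta> \<nu> * spectral_norm (A l p))"
      using approx(1) pos
      by (intro mult_mono approx(2)[OF l p] smooth(2)[OF p] spectral_norm_nonneg) simp
    also have "\<dots> = C\<^sub>A * \<eta> \<nu>"
      using pos by simp
    finally show ?thesis .
  qed
  have "(\<lambda>\<nu>. C\<^sub>A * \<eta> \<nu>) \<longlonglongrightarrow> 0"
    using tendsto_mult_right_zero[OF smooth(1)] .
  then have "eventually (\<lambda>\<nu>. C\<^sub>A * \<eta> \<nu> < \<zeta>) sequentially"
    by (rule order_tendstoD(2)) (simp add: \<open>0 < \<zeta> \<and> \<zeta> < 1\<close>)
  \<comment> \<open>This threshold comes from the limit of \<eta> alone, before any level or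
    parameter is fixed, which makes it uniform in both.\<close>
  then obtain \<nu>\<^sub>0 where "\<And>\<nu>. \<nu> \<ge> \<nu>\<^sub>0 \<Longrightarrow> C\<^sub>A * \<eta> \<nu> < \<zeta>"
    by (auto simp: eventually_sequentially)
  then show "\<exists>\<nu>\<^sub>0::nat. \<forall>\<nu>\<ge>\<nu>\<^sub>0. \<forall>l\<ge>1. \<forall>p\<in>I.
      spectral_norm (two_grid_matrix A S P R \<nu> l p) \<le> C\<^sub>A * \<eta> \<nu> \<and> C\<^sub>A * \<eta> \<nu> \<le> \<zeta>"
    using bound less_imp_le by blast
qed

end
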